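(* For every ring $R$, the partially ordered set $\overline{\operatorname{Hom}(R)}$ is a bounded lattice.
   Context: All rings are associative with identity $1\neq 0$ and ring morphisms send $1$ to $1$. $U(S)$ denotes the group of two-sided invertible elements of a ring $S$. For a ring $R$, $\operatorname{Hom}(R)$ denotes the set of all pairs $(\ker(\varphi),\varphi^{-1}(U(S)))$ where $\varphi\colon R\to S$ is a ring morphism into an arbitrary ring $S$, partially ordered by $(\mathfrak a,M)\le(\mathfrak b,N)$ if and only if $\mathfrak a\subseteq\mathfrak b$ and $M\subseteq N$. $\overline{\operatorname{Hom}(R)}:=\operatorname{Hom}(R)\,\dot\cup\,\{1\}$ is the partially ordered set obtained by adjoining a new greatest element $1$, so that $(\mathfrak a,M)\le 1$ for every $(\mathfrak a,M)\in\operatorname{Hom}(R)$. *)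

theory Defs
  imports "HOL-Algebra.Algebra" "HOL-Algebra.Weak_Morphisms"
begin

section \<open>The set of pairs attached to ring morphisms\<close>

text \<open>
  A \<open>ring\<close> of HOL-Algebra is associative and unital but may be the zero ring, and elements
  of \<^const>\<open>ring_hom\<close> preserve \<open>1\<close>. The condition \<open>1 \<noteq> 0\<close> is therefore explicit.

  A definition cannot quantify over all rings on all types, so the codomains \<open>S\<close> below have their
  carrier in the type \<open>'a list\<close>. This loses nothing: lemma \<open>Hom_memI\<close> shows that the
  pair of a morphism into a nonzero ring over any type whatsoever lies in \<open>Hom R\<close>. The reason is
  that the pair depends only on the subring of \<open>S\<close> generated by \<open>\<phi>(R)\<close> and the
  inverses of the units in \<open>\<phi>(R)\<close>, which embeds into \<open>'a list\<close> as a set.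
\<close>

definition Hom :: "('a, 'm) ring_scheme \<Rightarrow> ('a set \<times> 'a set) set" where
  "Hom R = {(a_kernel R S \<phi>, {x \<in> carrier R. \<phi> x \<in> Units S}) | (S :: 'a list ring) \<phi>.
      ring S \<and> \<one>\<^bsub>S\<^esub> \<noteq> \<zero>\<^bsub>S\<^esub> \<and> \<phi> \<in> ring_hom R S}"

definition Hom_le :: "'a set \<times> 'a set \<Rightarrow> 'a set \<times> 'a set \<Rightarrow> bool" where
  "Hom_le p q \<longleftrightarrow> fst p \<subseteq> fst q \<and> snd p \<subseteq> snd q"

text \<open>The adjoined greatest element is \<^const>\<open>None\<close>.\<close>

definition Hom_bar :: "('a, 'm) ring_scheme \<Rightarrow> ('a set \<times> 'a set) option gorder" where
  "Hom_bar R = \<lparr>carrier = insert None (Some ` Hom R), eq = (=),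
     le = (\<lambda>x y. case y of None \<Rightarrow> True
                 | Some q \<Rightarrow> (case x of None \<Rightarrow> False | Some p \<Rightarrow> Hom_le p q))\<rparr>"


section \<open>Independence of the type of the codomain\<close>

datatype 'a rterm = One | Elem 'a | Inv 'a | Neg "'a rterm"
  | Add "'a rterm" "'a rterm" | Mul "'a rterm" "'a rterm"

lemma ex_inj_rterm_list: "\<exists>e :: 'a rterm \<Rightarrow> 'a list. inj e"
proof -
  have "|UNIV \<times> UNIV :: ('a list \<times> 'a list) set| =o |UNIV :: 'a list set|"
    by (rule card_of_Times_same_infinite) (rule infinite_UNIV_listI)
  then obtain p :: "'a list \<times> 'a list \<Rightarrow> 'a list" where p: "inj p"
    by (auto simp: card_of_ordIso[symmetric] bij_betw_def)
  define c :: "nat \<Rightarrow> 'a list" where "c = (\<lambda>n. replicate n undefined)"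
  have c: "c m = c n \<longleftrightarrow> m = n" for m n
    unfolding c_def by (metis length_replicate)
  have pp: "p u = p v \<longleftrightarrow> u = v" for u v
    by (rule inj_eq[OF p])
  define e :: "'a rterm \<Rightarrow> 'a list" where
    "e = rec_rterm (p (c 0, [])) (\<lambda>a. p (c 1, [a])) (\<lambda>a. p (c 2, [a])) (\<lambda>_ u. p (c 3, u))
       (\<lambda>_ _ u v. p (c 4, p (u, v))) (\<lambda>_ _ u v. p (c 5, p (u, v)))"
  have e: "e One = p (c 0, [])" "e (Elem a) = p (c 1, [a])" "e (Inv a) = p (c 2, [a])"
    "e (Neg s) = p (c 3, e s)" "e (Add s t) = p (c 4, p (e s, e t))"
    "e (Mul s t) = p (c 5, p (e s, e t))" for a s t
    by (simp_all add: e_def)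
  have "s = t" if "e s = e t" for s t
    using that
  proof (induction s arbitrary: t)
    case One then show ?case by (cases t) (auto simp: e pp c)
  next
    case (Elem x) then show ?case by (cases t) (auto simp: e pp c)
  next
    case (Inv x) then show ?case by (cases t) (auto simp: e pp c)
  next
    case (Neg s) then show ?case by (cases t) (auto simp: e pp c)
  next
    case (Add s1 s2) then show ?case by (cases t) (auto simp: e pp c)
  next
    case (Mul s1 s2) then show ?case by (cases t) (auto simp: e pp c)
  qed
  then show ?thesis by (auto simp: inj_def)
qed

lemma Hom_memI:
  fixes R :: "('a, 'm) ring_scheme" and S :: "('c, 'n) ring_scheme"
  assumes "ring S" and nz: "\<one>\<^bsub>S\<^esub> \<noteq> \<zero>\<^bsub>S\<^esub>" and phi: "\<phi> \<in> ring_hom R S"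
  shows "(a_kernel R S \<phi>, {x \<in> carrier R. \<phi> x \<in> Units S}) \<in> Hom R"
proof -
  interpret S: ring S by fact
  define H where "H = \<phi> ` carrier R \<union> {inv\<^bsub>S\<^esub> (\<phi> x) | x. x \<in> carrier R \<and> \<phi> x \<in> Units S}"
  define T where "T = generate_ring S H"
  have phic: "\<phi> x \<in> carrier S" if "x \<in> carrier R" for x
    using phi that by (rule ring_hom_closed)
  have Hc: "H \<subseteq> carrier S" unfolding H_def using phic by auto
  have HT: "H \<subseteq> T" unfolding T_def by (auto intro: generate_ring.incl)
  have Tc: "T \<subseteq> carrier S" unfolding T_def by (rule S.generate_ring_incl[OF Hc])
  let ?S1 = "S\<lparr>carrier := T\<rparr>"
  have S1: "ring ?S1" unfolding T_def by (rule S.generate_ring_is_ring[OF Hc])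
  interpret S1: ring ?S1 by (rule S1)
  define val where "val = rec_rterm \<one>\<^bsub>S\<^esub> \<phi> (\<lambda>x. inv\<^bsub>S\<^esub> (\<phi> x)) (\<lambda>_ u. \<ominus>\<^bsub>S\<^esub> u)
    (\<lambda>_ _ u v. u \<oplus>\<^bsub>S\<^esub> v) (\<lambda>_ _ u v. u \<otimes>\<^bsub>S\<^esub> v)"
  have "t \<in> range val" if "t \<in> T" for t
    using that unfolding T_def
  proof (induction rule: generate_ring.induct)
    case one show ?case by (rule range_eqI[of _ _ One]) (simp add: val_def)
  next
    case (incl h)
    then consider x where "h = \<phi> x" | x where "h = inv\<^bsub>S\<^esub> (\<phi> x)" unfolding H_def by auto
    then show ?case
    proof cases
      case 1 then show ?thesis by (intro range_eqI[of _ _ "Elem x"]) (simp add: val_def)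
    next
      case 2 then show ?thesis by (intro range_eqI[of _ _ "Inv x"]) (simp add: val_def)
    qed
  next
    case (a_inv h)
    then obtain s where "h = val s" by auto
    then show ?case by (intro range_eqI[of _ _ "Neg s"]) (simp add: val_def)
  next
    case (eng_add h1 h2)
    then obtain s t where "h1 = val s" "h2 = val t" by auto
    then show ?case by (intro range_eqI[of _ _ "Add s t"]) (simp add: val_def)
  next
    case (eng_mult h1 h2)
    then obtain s t where "h1 = val s" "h2 = val t" by auto
    then show ?case by (intro range_eqI[of _ _ "Mul s t"]) (simp add: val_def)
  qed
  then have "T \<subseteq> range val" by auto
  then have injv: "inj_on (inv_into UNIV val) T" by (rule inj_on_inv_into)
  obtain e :: "'a rterm \<Rightarrow> 'a list" where "inj e" using ex_inj_rterm_list by blast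
  define f where "f = e \<circ> inv_into UNIV val"
  have injf: "inj_on f T"
    unfolding f_def using injv \<open>inj e\<close> by (auto intro: comp_inj_on inj_on_subset)
  define S2 where "S2 = image_ring f ?S1"
  have S2: "ring S2" unfolding S2_def by (rule S1.inj_imp_image_ring_is_ring) (simp add: injf)
  have iso: "f \<in> ring_iso ?S1 S2"
    unfolding S2_def by (rule inj_imp_image_ring_iso) (simp add: injf)
  have car2: "carrier S2 = f ` T" and one2: "\<one>\<^bsub>S2\<^esub> = f \<one>\<^bsub>S\<^esub>" and zero2: "\<zero>\<^bsub>S2\<^esub> = f \<zero>\<^bsub>S\<^esub>"
    unfolding S2_def by (simp_all add: image_ring_carrier image_ring_one image_ring_zero)
  have mult2: "f u \<otimes>\<^bsub>S2\<^esub> f v = f (u \<otimes>\<^bsub>S\<^esub> v)" and add2: "f u \<oplus>\<^bsub>S2\<^esub> f v = f (u \<oplus>\<^bsub>S\<^esub> v)"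
    if "u \<in> T" "v \<in> T" for u v
    using iso that by (auto simp: ring_iso_def ring_hom_def)
  have T1: "\<one>\<^bsub>S\<^esub> \<in> T" and T0: "\<zero>\<^bsub>S\<^esub> \<in> T" using S1.one_closed S1.zero_closed by auto
  have Tm: "u \<otimes>\<^bsub>S\<^esub> v \<in> T" if "u \<in> T" "v \<in> T" for u v
    using S1.m_closed that by simp
  have phiT: "\<phi> x \<in> T" if "x \<in> carrier R" for x
    using HT that by (auto simp: H_def)
  have feq: "f u = f v \<longleftrightarrow> u = v" if "u \<in> T" "v \<in> T" for u v
    using injf that by (auto dest: inj_onD)
  have nz2: "\<one>\<^bsub>S2\<^esub> \<noteq> \<zero>\<^bsub>S2\<^esub>" using nz by (simp add: one2 zero2 feq T1 T0)
  have hom2: "f \<circ> \<phi> \<in> ring_hom R S2"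
    using phi by (auto simp: ring_hom_def car2 phiT one2 mult2 add2)
  have "a_kernel R S2 (f \<circ> \<phi>) = a_kernel R S \<phi>"
    by (auto simp: a_kernel_def' zero2 feq phiT T0)
  moreover have "f (\<phi> x) \<in> Units S2 \<longleftrightarrow> \<phi> x \<in> Units S" if x: "x \<in> carrier R" for x
  proof
    assume "f (\<phi> x) \<in> Units S2"
    then obtain v where v: "v \<in> T" "f v \<otimes>\<^bsub>S2\<^esub> f (\<phi> x) = \<one>\<^bsub>S2\<^esub>" "f (\<phi> x) \<otimes>\<^bsub>S2\<^esub> f v = \<one>\<^bsub>S2\<^esub>"
      unfolding Units_def car2 by auto
    then have "v \<otimes>\<^bsub>S\<^esub> \<phi> x = \<one>\<^bsub>S\<^esub>" "\<phi> x \<otimes>\<^bsub>S\<^esub> v = \<one>\<^bsub>S\<^esub>"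
      using phiT[OF x] by (simp_all add: mult2 one2 feq Tm T1)
    then show "\<phi> x \<in> Units S" using v(1) Tc phic[OF x] by (auto simp: Units_def)
  next
    assume u: "\<phi> x \<in> Units S"
    then have i: "inv\<^bsub>S\<^esub> (\<phi> x) \<in> T" using x HT by (auto simp: H_def)
    have "f (inv\<^bsub>S\<^esub> (\<phi> x)) \<otimes>\<^bsub>S2\<^esub> f (\<phi> x) = \<one>\<^bsub>S2\<^esub>" "f (\<phi> x) \<otimes>\<^bsub>S2\<^esub> f (inv\<^bsub>S\<^esub> (\<phi> x)) = \<one>\<^bsub>S2\<^esub>"
      using u i phiT[OF x] by (simp_all add: mult2 one2)
    then show "f (\<phi> x) \<in> Units S2" using i phiT[OF x] by (auto simp: Units_def car2)
  qed
  then have "{x \<in> carrier R. (f \<circ> \<phi>) x \<in> Units S2} = {x \<in> carrier R. \<phi> x \<in> Units S}"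
    by auto
  ultimately show ?thesis
    unfolding Hom_def using S2 nz2 hom2 by (intro CollectI exI[of _ S2] exI[of _ "f \<circ> \<phi>"]) simp
qed

end

theory Submission
  imports Defs
begin

text \<open>
  The set of pairs \<open>Hom R\<close> is closed under componentwise intersection of arbitrary nonempty families.
  Indeed, if the \<open>i\<close>-th pair comes from a morphism \<open>\<phi>\<^sub>i : R \<rightarrow> S\<^sub>i\<close>, then the intersection comes from the
  induced morphism \<open>R \<rightarrow> \<Prod>\<^sub>i S\<^sub>i\<close>: an element of a product ring is zero, or invertible, exactly when
  each of its components is. So every nonempty family in \<open>Hom R\<close> has an infimum.

  The adjoined greatest element is the infimum of the empty family, hence arbitrary infima exist in
  \<open>Hom_bar R\<close>, and arbitrary suprema follow as the infima of the sets of upper bounds. Thus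
  \<open>Hom_bar R\<close> is a complete lattice, and in particular a bounded one. Taking all upper bounds at once
  requires products of infinite families, which is why products over arbitrary index sets are used
  even for the supremum of two elements.
\<close>

definition product_ring :: "'i set \<Rightarrow> ('i \<Rightarrow> ('b, 'n) ring_scheme) \<Rightarrow> ('i \<Rightarrow> 'b) ring" where
  "product_ring I S = \<lparr>carrier = (\<Pi>\<^sub>E i\<in>I. carrier (S i)),
     monoid.mult = (\<lambda>x y. \<lambda>i\<in>I. x i \<otimes>\<^bsub>S i\<^esub> y i), one = (\<lambda>i\<in>I. \<one>\<^bsub>S i\<^esub>),
     ring.zero = (\<lambda>i\<in>I. \<zero>\<^bsub>S i\<^esub>), add = (\<lambda>x y. \<lambda>i\<in>I. x i \<oplus>\<^bsub>S i\<^esub> y i)\<rparr>"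

lemma product_ring_simps [simp]:
  "carrier (product_ring I S) = (\<Pi>\<^sub>E i\<in>I. carrier (S i))"
  "x \<otimes>\<^bsub>product_ring I S\<^esub> y = (\<lambda>i\<in>I. x i \<otimes>\<^bsub>S i\<^esub> y i)"
  "\<one>\<^bsub>product_ring I S\<^esub> = (\<lambda>i\<in>I. \<one>\<^bsub>S i\<^esub>)"
  "\<zero>\<^bsub>product_ring I S\<^esub> = (\<lambda>i\<in>I. \<zero>\<^bsub>S i\<^esub>)"
  "x \<oplus>\<^bsub>product_ring I S\<^esub> y = (\<lambda>i\<in>I. x i \<oplus>\<^bsub>S i\<^esub> y i)"
  by (simp_all add: product_ring_def)

lemma ring_product_ring:
  assumes S: "\<And>i. i \<in> I \<Longrightarrow> ring (S i)"
  shows "ring (product_ring I S)"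
proof -
  note S_simps = ring.ring_simprules[OF S]
  have mem: "x i \<in> carrier (S i)" if "x \<in> (\<Pi>\<^sub>E i\<in>I. carrier (S i))" "i \<in> I" for x i
    using that by (rule PiE_mem)
  have eqI: "(\<lambda>i\<in>I. f i) = x"
    if "x \<in> (\<Pi>\<^sub>E i\<in>I. carrier (S i))" "\<And>i. i \<in> I \<Longrightarrow> f i = x i" for f x
  proof
    show "restrict f I i = x i" for i
      using that PiE_arb[OF that(1)] by (cases "i \<in> I") simp_all
  qed
  show ?thesis
  proof (rule ringI)
    show "abelian_group (product_ring I S)"
    proof (rule abelian_groupI)
      fix x assume x: "x \<in> carrier (product_ring I S)"
      show "\<exists>y\<in>carrier (product_ring I S). y \<oplus>\<^bsub>product_ring I S\<^esub> x = \<zero>\<^bsub>product_ring I S\<^esub>"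
        using x by (intro bexI[of _ "\<lambda>i\<in>I. \<ominus>\<^bsub>S i\<^esub> x i"])
          (auto simp: S_simps mem intro!: restrict_ext)
      show "\<zero>\<^bsub>product_ring I S\<^esub> \<oplus>\<^bsub>product_ring I S\<^esub> x = x"
        using x by (auto simp: S_simps monoid.r_one[OF ring.is_monoid[OF S]] mem intro!: eqI)
    qed (auto simp: S_simps mem intro!: restrict_ext)
    show "monoid (product_ring I S)"
    proof (rule monoidI)
      fix x assume x: "x \<in> carrier (product_ring I S)"
      show "\<one>\<^bsub>product_ring I S\<^esub> \<otimes>\<^bsub>product_ring I S\<^esub> x = x"
        using x by (auto simp: S_simps monoid.r_one[OF ring.is_monoid[OF S]] mem intro!: eqI)
      show "x \<otimes>\<^bsub>product_ring I S\<^esub> \<one>\<^bsub>product_ring I S\<^esub> = x"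
        using x by (auto simp: S_simps monoid.r_one[OF ring.is_monoid[OF S]] mem intro!: eqI)
    qed (auto simp: S_simps mem intro!: restrict_ext)
  qed (auto simp: S_simps mem intro!: restrict_ext)
qed

text \<open>Componentwise inverses are collected into one element of the product by choice.\<close>

lemma Units_product_ring:
  "x \<in> Units (product_ring I S) \<longleftrightarrow>
    x \<in> (\<Pi>\<^sub>E i\<in>I. carrier (S i)) \<and> (\<forall>i\<in>I. x i \<in> Units (S i))"
proof
  assume "x \<in> Units (product_ring I S)"
  then obtain y where xy: "x \<in> (\<Pi>\<^sub>E i\<in>I. carrier (S i))" "y \<in> (\<Pi>\<^sub>E i\<in>I. carrier (S i))"
      and eq: "(\<lambda>i\<in>I. y i \<otimes>\<^bsub>S i\<^esub> x i) = (\<lambda>i\<in>I. \<one>\<^bsub>S i\<^esub>)" "(\<lambda>i\<in>I. x i \<otimes>\<^bsub>S i\<^esub> y i) = (\<lambda>i\<in>I. \<one>\<^bsub>S i\<^esub>)"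
    unfolding Units_def product_ring_simps by blast
  have "y i \<otimes>\<^bsub>S i\<^esub> x i = \<one>\<^bsub>S i\<^esub> \<and> x i \<otimes>\<^bsub>S i\<^esub> y i = \<one>\<^bsub>S i\<^esub>" if "i \<in> I" for i
    using fun_cong[OF eq(1), of i] fun_cong[OF eq(2), of i] that by simp
  with xy show "x \<in> (\<Pi>\<^sub>E i\<in>I. carrier (S i)) \<and> (\<forall>i\<in>I. x i \<in> Units (S i))"
    by (auto simp: Units_def dest: PiE_mem)
next
  assume x: "x \<in> (\<Pi>\<^sub>E i\<in>I. carrier (S i)) \<and> (\<forall>i\<in>I. x i \<in> Units (S i))"
  then have "\<forall>i\<in>I. \<exists>z\<in>carrier (S i). z \<otimes>\<^bsub>S i\<^esub> x i = \<one>\<^bsub>S i\<^esub> \<and> x i \<otimes>\<^bsub>S i\<^esub> z = \<one>\<^bsub>S i\<^esub>"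
    by (auto simp: Units_def)
  then obtain y where "\<forall>i\<in>I. y i \<in> carrier (S i) \<and> y i \<otimes>\<^bsub>S i\<^esub> x i = \<one>\<^bsub>S i\<^esub> \<and> x i \<otimes>\<^bsub>S i\<^esub> y i = \<one>\<^bsub>S i\<^esub>"
    by metis
  with x show "x \<in> Units (product_ring I S)"
    unfolding Units_def by (auto intro!: bexI[of _ "restrict y I"] restrict_ext)
qed

lemma ring_hom_product_ring:
  assumes "\<And>i. i \<in> I \<Longrightarrow> \<phi> i \<in> ring_hom R (S i)"
  shows "(\<lambda>x. \<lambda>i\<in>I. \<phi> i x) \<in> ring_hom R (product_ring I S)"
  using ring_hom_memE[OF assms] by (intro ring_hom_memI) (auto intro!: restrict_ext)

text \<open>
  The product of the chosen codomains realises the intersection. The family must be nonempty because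
  the empty product is the zero ring.
\<close>

lemma Hom_Inter_closed:
  fixes R :: "('a, 'm) ring_scheme"
  assumes A: "A \<subseteq> Hom R" and "A \<noteq> {}"
  shows "(\<Inter>p\<in>A. fst p, \<Inter>p\<in>A. snd p) \<in> Hom R"
proof -
  have "\<forall>p\<in>A. \<exists>(S :: 'a list ring) \<phi>. ring S \<and> \<one>\<^bsub>S\<^esub> \<noteq> \<zero>\<^bsub>S\<^esub> \<and> \<phi> \<in> ring_hom R S
      \<and> p = (a_kernel R S \<phi>, {x \<in> carrier R. \<phi> x \<in> Units S})"
    using A unfolding Hom_def by blast
  from this[unfolded bchoice_iff] obtain S :: "'a set \<times> 'a set \<Rightarrow> 'a list ring" and \<phi>
    where S: "\<And>p. p \<in> A \<Longrightarrow> ring (S p)" "\<And>p. p \<in> A \<Longrightarrow> \<one>\<^bsub>S p\<^esub> \<noteq> \<zero>\<^bsub>S p\<^esub>"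
      and \<phi>: "\<And>p. p \<in> A \<Longrightarrow> \<phi> p \<in> ring_hom R (S p)"
      and p: "\<And>p. p \<in> A \<Longrightarrow> p = (a_kernel R (S p) (\<phi> p), {x \<in> carrier R. \<phi> p x \<in> Units (S p)})"
    by blast
  define P where "P = product_ring A S"
  define \<psi> where "\<psi> = (\<lambda>x. \<lambda>p\<in>A. \<phi> p x)"
  have fst_p: "fst p = {x \<in> carrier R. \<phi> p x = \<zero>\<^bsub>S p\<^esub>}" if "p \<in> A" for p
    using p[OF that] by (metis a_kernel_def' fst_conv)
  have snd_p: "snd p = {x \<in> carrier R. \<phi> p x \<in> Units (S p)}" if "p \<in> A" for p
    using p[OF that] by (metis snd_conv)
  have restrict_eq: "restrict f A = restrict g A \<longleftrightarrow> (\<forall>p\<in>A. f p = g p)"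
    for f g :: "'a set \<times> 'a set \<Rightarrow> 'a list"
    by (metis restrict_apply' restrict_ext)
  have "ring P"
    unfolding P_def using S(1) by (rule ring_product_ring)
  moreover have "\<one>\<^bsub>P\<^esub> \<noteq> \<zero>\<^bsub>P\<^esub>"
    using \<open>A \<noteq> {}\<close> S(2) by (auto simp: P_def restrict_eq)
  moreover have "\<psi> \<in> ring_hom R P"
    unfolding P_def \<psi>_def using \<phi> by (rule ring_hom_product_ring)
  ultimately have "(a_kernel R P \<psi>, {x \<in> carrier R. \<psi> x \<in> Units P}) \<in> Hom R"
    by (rule Hom_memI)
  moreover have "a_kernel R P \<psi> = (\<Inter>p\<in>A. fst p)"
    using \<open>A \<noteq> {}\<close> by (auto simp: a_kernel_def' P_def \<psi>_def restrict_eq fst_p)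
  moreover have "{x \<in> carrier R. \<psi> x \<in> Units P} = (\<Inter>p\<in>A. snd p)"
    using \<open>A \<noteq> {}\<close> by (auto simp: P_def \<psi>_def Units_product_ring snd_p ring_hom_closed[OF \<phi>])
  ultimately show ?thesis by simp
qed

lemma Hom_bar_simps [simp]:
  "carrier (Hom_bar R) = insert None (Some ` Hom R)"
  "x .=\<^bsub>Hom_bar R\<^esub> y \<longleftrightarrow> x = y"
  "x \<sqsubseteq>\<^bsub>Hom_bar R\<^esub> None"
  "\<not> None \<sqsubseteq>\<^bsub>Hom_bar R\<^esub> Some q"
  "Some p \<sqsubseteq>\<^bsub>Hom_bar R\<^esub> Some q \<longleftrightarrow> Hom_le p q"
  by (simp_all add: Hom_bar_def)

lemma partial_order_Hom_bar: "partial_order (Hom_bar R)"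
  by unfold_locales (auto simp: Hom_le_def prod_eq_iff fun_eq_iff, blast+)

lemma Hom_bar_inf_exists:
  assumes A: "A \<subseteq> carrier (Hom_bar R)"
  shows "\<exists>i. greatest (Hom_bar R) i (Lower (Hom_bar R) A)"
proof -
  define B where "B = {p. Some p \<in> A}"
  show ?thesis
  proof (cases "B = {}")
    case True
    then have "x = None" if "x \<in> A" for x
      using that by (cases x) (auto simp: B_def)
    then have "greatest (Hom_bar R) None (Lower (Hom_bar R) A)"
      by (auto simp: greatest_def Lower_def)
    then show ?thesis ..
  next
    case False
    let ?m = "(\<Inter>p\<in>B. fst p, \<Inter>p\<in>B. snd p)"
    have m: "?m \<in> Hom R"
      using A False by (intro Hom_Inter_closed) (auto simp: B_def)
    have "Some ?m \<sqsubseteq>\<^bsub>Hom_bar R\<^esub> x" if "x \<in> A" for x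
      using that by (cases x) (auto simp: B_def Hom_le_def)
    then have "Some ?m \<in> Lower (Hom_bar R) A"
      using m by (intro Lower_memI) auto
    moreover have "x \<sqsubseteq>\<^bsub>Hom_bar R\<^esub> Some ?m" if "x \<in> Lower (Hom_bar R) A" for x
    proof -
      have le: "x \<sqsubseteq>\<^bsub>Hom_bar R\<^esub> Some p" if "p \<in> B" for p
        using Lower_memD[OF \<open>x \<in> Lower (Hom_bar R) A\<close> _ A] that by (simp add: B_def)
      with False obtain q where "x = Some q"
        by (cases x) auto
      with le show ?thesis
        by (auto simp: Hom_le_def)
    qed
    ultimately have "greatest (Hom_bar R) (Some ?m) (Lower (Hom_bar R) A)"
      unfolding greatest_def by (intro conjI ballI Lower_closed)
    then show ?thesis ..
  qed
qed

theorem complete_lattice_Hom_bar: "complete_lattice (Hom_bar R)"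
proof (rule partial_order.complete_lattice_criterion1[OF partial_order_Hom_bar])
  show "\<exists>g. greatest (Hom_bar R) g (carrier (Hom_bar R))"
    by (rule exI[of _ None]) (auto simp: greatest_def)
qed (rule Hom_bar_inf_exists)

theorem theorem6p3:
  fixes R :: "('a, 'm) ring_scheme"
  assumes "ring R" and "\<one>\<^bsub>R\<^esub> \<noteq> \<zero>\<^bsub>R\<^esub>"
  shows "bounded_lattice (Hom_bar R)"
proof -
  interpret complete_lattice "Hom_bar R"
    by (rule complete_lattice_Hom_bar)
  show ?thesis
    by unfold_locales
qed

end
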